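(* Let $R$ be an integral domain (not a field) that is finitely stable and an LPI-domain, and assume every fractional overring of $R$ is an LPI-domain. Then $R$ has finite character.
   Context: Let $R$ be an integral domain with quotient field $K\neq R$. An overring of $R$ is a domain $D$ with $R\subseteq D\subseteq K$; it is fractional if there is a nonzero $d\in R$ with $dD\subseteq R$. For a nonzero ideal $I$ of $R$, $E(I):=(I:I)=\{x\in K: xI\subseteq I\}$. An ideal $I$ of a domain is locally principal if $IR_M$ is principal for every maximal ideal $M$; it is invertible if $I(R:I)=R$, where $(R:I)=\{x\in K: xI\subseteq R\}$. A domain is an LPI-domain if every locally principal nonzero ideal of it is invertible. A nonzero ideal $I$ is stable if it is invertible as an ideal of the ring $E(I)$; $R$ is finitely stable if every nonzero finitely generated ideal of $R$ is stable. $R$ has finite character if every nonzero element of $R$ lies in only finitely many maximal ideals of $R$. *)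

theory Defs
  imports Main
begin

text \<open>We work inside a field of type 'a, which plays the role of the quotient field K of R.
  Subrings, overrings, ideals etc. are subsets of this field.\<close>

definition subring :: "'a::field set \<Rightarrow> bool" where
  "subring D \<longleftrightarrow> 0 \<in> D \<and> 1 \<in> D \<and> (\<forall>x\<in>D. \<forall>y\<in>D. x + y \<in> D \<and> x - y \<in> D \<and> x * y \<in> D)"

definition quotient_field_of :: "'a::field set \<Rightarrow> bool" where
  "quotient_field_of R \<longleftrightarrow> subring R \<and> (\<forall>x. \<exists>a\<in>R. \<exists>b\<in>R. b \<noteq> 0 \<and> x = a / b)"

definition ideal_of :: "'a::field set \<Rightarrow> 'a set \<Rightarrow> bool" where
  "ideal_of I D \<longleftrightarrow> I \<subseteq> D \<and> 0 \<in> I \<and> (\<forall>x\<in>I. \<forall>y\<in>I. x + y \<in> I) \<and> (\<forall>x\<in>I. - x \<in> I)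
     \<and> (\<forall>d\<in>D. \<forall>x\<in>I. d * x \<in> I)"

definition maximal_ideal_of :: "'a::field set \<Rightarrow> 'a set \<Rightarrow> bool" where
  "maximal_ideal_of M D \<longleftrightarrow> ideal_of M D \<and> M \<noteq> D \<and>
     (\<forall>J. ideal_of J D \<and> M \<subseteq> J \<longrightarrow> J = M \<or> J = D)"

definition set_prod_sums :: "'a::field set \<Rightarrow> 'a set \<Rightarrow> 'a set" where
  "set_prod_sums A B = {(\<Sum>i<n. a i * b i) | (n::nat) a b. \<forall>i<n. a i \<in> A \<and> b i \<in> B}"

definition overring :: "'a::field set \<Rightarrow> 'a set \<Rightarrow> bool" where
  "overring R D \<longleftrightarrow> subring D \<and> R \<subseteq> D"

definition fractional_overring :: "'a::field set \<Rightarrow> 'a set \<Rightarrow> bool" where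
  "fractional_overring R D \<longleftrightarrow> overring R D \<and> (\<exists>d\<in>R. d \<noteq> 0 \<and> (\<lambda>x. d * x) ` D \<subseteq> R)"

definition endo_ring :: "'a::field set \<Rightarrow> 'a set" where
  "endo_ring I = {x. \<forall>i\<in>I. x * i \<in> I}"

definition colon :: "'a::field set \<Rightarrow> 'a set \<Rightarrow> 'a set" where
  "colon D I = {x. \<forall>i\<in>I. x * i \<in> D}"

definition localization :: "'a::field set \<Rightarrow> 'a set \<Rightarrow> 'a set" where
  "localization D M = {a / s | a s. a \<in> D \<and> s \<in> D \<and> s \<notin> M}"

definition principal_ideal_of :: "'a::field set \<Rightarrow> 'a set \<Rightarrow> bool" where
  "principal_ideal_of J S \<longleftrightarrow> (\<exists>a\<in>S. J = {a * y | y. y \<in> S})"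

definition locally_principal :: "'a::field set \<Rightarrow> 'a set \<Rightarrow> bool" where
  "locally_principal I D \<longleftrightarrow> (\<forall>M. maximal_ideal_of M D \<longrightarrow>
      principal_ideal_of (set_prod_sums I (localization D M)) (localization D M))"

definition invertible_ideal :: "'a::field set \<Rightarrow> 'a set \<Rightarrow> bool" where
  "invertible_ideal I D \<longleftrightarrow> set_prod_sums I (colon D I) = D"

definition LPI_domain :: "'a::field set \<Rightarrow> bool" where
  "LPI_domain D \<longleftrightarrow> (\<forall>I. ideal_of I D \<and> I \<noteq> {0} \<and> locally_principal I D \<longrightarrow> invertible_ideal I D)"

definition stable_ideal :: "'a::field set \<Rightarrow> bool" where
  "stable_ideal I \<longleftrightarrow> invertible_ideal I (endo_ring I)"

definition finitely_generated_ideal :: "'a::field set \<Rightarrow> 'a set \<Rightarrow> bool" where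
  "finitely_generated_ideal I D \<longleftrightarrow> (\<exists>F. finite F \<and> F \<subseteq> D \<and> I = set_prod_sums D F)"

definition finitely_stable :: "'a::field set \<Rightarrow> bool" where
  "finitely_stable R \<longleftrightarrow> (\<forall>I. ideal_of I R \<and> I \<noteq> {0} \<and> finitely_generated_ideal I R \<longrightarrow> stable_ideal I)"

definition finite_character :: "'a::field set \<Rightarrow> bool" where
  "finite_character R \<longleftrightarrow> (\<forall>x\<in>R. x \<noteq> 0 \<longrightarrow> finite {M. maximal_ideal_of M R \<and> x \<in> M})"

end

theory Submission
  imports Defs
begin

text \<open>If a nonzero \<open>x\<close> lies in infinitely many maximal ideals, then it lies in infinitely many
  pairwise comaximal proper finitely generated ideals \<open>I\<^sub>0, I\<^sub>1, \<dots>\<close>. By comaximality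
  \<open>E(I\<^sub>k) E(I\<^sub>l) \<subseteq> E(I\<^sub>k) + E(I\<^sub>l)\<close>, so \<open>T = \<Sum>\<^sub>n E(I\<^sub>n)\<close> is a ring, and \<open>x T \<subseteq> R\<close>; hence \<open>T\<close> is an
  LPI-domain. By stability the ideals \<open>J\<^sub>n = I\<^sub>n T\<close> of \<open>T\<close> are invertible; they are still proper and
  pairwise comaximal. The ideal \<open>\<Sum>\<^sub>n x J\<^sub>n\<^sup>-\<^sup>1\<close> of \<open>T\<close> is locally principal, since a maximal ideal
  contains at most one \<open>J\<^sub>n\<close>; so it is invertible, hence finitely generated, and therefore
  \<open>J\<^sub>N\<^sup>-\<^sup>1 \<subseteq> \<Sum>\<^sub>n\<^sub><\<^sub>N J\<^sub>n\<^sup>-\<^sup>1\<close> for some \<open>N\<close>, which is impossible by comaximality.\<close>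

subsection \<open>Rings and ideals inside a field\<close>

lemma subringD:
  assumes "subring D"
  shows "0 \<in> D" "1 \<in> D" "x \<in> D \<Longrightarrow> y \<in> D \<Longrightarrow> x + y \<in> D"
    "x \<in> D \<Longrightarrow> y \<in> D \<Longrightarrow> x - y \<in> D" "x \<in> D \<Longrightarrow> y \<in> D \<Longrightarrow> x * y \<in> D"
  using assms by (auto simp: subring_def)

lemma subring_uminus: "subring D \<Longrightarrow> x \<in> D \<Longrightarrow> - x \<in> D"
  by (metis diff_0 subringD(1) subringD(4))

lemma idealD:
  assumes "ideal_of I D"
  shows "I \<subseteq> D" "0 \<in> I" "x \<in> I \<Longrightarrow> y \<in> I \<Longrightarrow> x + y \<in> I" "x \<in> I \<Longrightarrow> - x \<in> I"
    "d \<in> D \<Longrightarrow> x \<in> I \<Longrightarrow> d * x \<in> I"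
  using assms by (auto simp: ideal_of_def)

lemma ideal_diff: "ideal_of I D \<Longrightarrow> x \<in> I \<Longrightarrow> y \<in> I \<Longrightarrow> x - y \<in> I"
  using idealD(3,4) by (metis diff_conv_add_uminus)

lemma ideal_one: "ideal_of I D \<Longrightarrow> 1 \<in> I \<Longrightarrow> I = D"
  using idealD(1,5) by (metis mult.right_neutral subsetI subset_antisym)

section \<open>Finite sums of products and generated ideals\<close>

lemma set_prod_sums_induct [consumes 1, case_names zero mult add]:
  assumes "z \<in> set_prod_sums A B"
    and "P 0" "\<And>a b. a \<in> A \<Longrightarrow> b \<in> B \<Longrightarrow> P (a * b)" "\<And>u v. P u \<Longrightarrow> P v \<Longrightarrow> P (u + v)"
  shows "P z"
proof -
  obtain n :: nat and a b where ab: "\<forall>i<n. a i \<in> A \<and> b i \<in> B" and z: "z = (\<Sum>i<n. a i * b i)"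
    using assms(1) unfolding set_prod_sums_def by blast
  have "k \<le> n \<Longrightarrow> P (\<Sum>i<k. a i * b i)" for k
    by (induction k) (use ab assms(2-4) in auto)
  then show ?thesis using z by simp
qed

lemma set_prod_sums_zero: "0 \<in> set_prod_sums A B"
  unfolding set_prod_sums_def by (auto intro!: exI[of _ "0::nat"])

lemma set_prod_sums_mult: "a \<in> A \<Longrightarrow> b \<in> B \<Longrightarrow> a * b \<in> set_prod_sums A B"
  unfolding set_prod_sums_def
  by (rule CollectI, intro exI[of _ "1::nat"] exI[of _ "\<lambda>_. a"] exI[of _ "\<lambda>_. b"]) auto

lemma set_prod_sums_add:
  assumes "u \<in> set_prod_sums A B" "v \<in> set_prod_sums A B"
  shows "u + v \<in> set_prod_sums A B"
proof -
  obtain n :: nat and a b where ab: "\<forall>i<n. a i \<in> A \<and> b i \<in> B" and u: "u = (\<Sum>i<n. a i * b i)"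
    using assms(1) unfolding set_prod_sums_def by blast
  \<comment> \<open>The terms of \<open>u\<close> are appended one by one to a representation of
    \<open>v\<close>, each at the new last index \<open>m\<close>; this avoids splicing two index
    ranges.\<close>
  have "k \<le> n \<Longrightarrow> (\<Sum>i<k. a i * b i) + v \<in> set_prod_sums A B" for k
  proof (induction k)
    case 0
    then show ?case using assms(2) by simp
  next
    case (Suc k)
    obtain m :: nat and c d where cd: "\<forall>i<m. c i \<in> A \<and> d i \<in> B"
      and w: "(\<Sum>i<k. a i * b i) + v = (\<Sum>i<m. c i * d i)"
      using Suc unfolding set_prod_sums_def by force
    have "(\<Sum>i<Suc k. a i * b i) + v
        = (\<Sum>i<Suc m. (if i < m then c i else a k) * (if i < m then d i else b k))"
      using w by (simp add: algebra_simps)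
    moreover have "\<forall>i<Suc m. (if i < m then c i else a k) \<in> A \<and> (if i < m then d i else b k) \<in> B"
      using cd ab Suc.prems by auto
    ultimately show ?case unfolding set_prod_sums_def
      by (intro CollectI exI[of _ "Suc m"] exI[of _ "\<lambda>i. if i < m then c i else a k"]
          exI[of _ "\<lambda>i. if i < m then d i else b k"] conjI)
  qed
  then show ?thesis using u by simp
qed

lemma set_prod_sums_least:
  assumes "0 \<in> C" "\<And>u v. u \<in> C \<Longrightarrow> v \<in> C \<Longrightarrow> u + v \<in> C"
    and "\<And>a b. a \<in> A \<Longrightarrow> b \<in> B \<Longrightarrow> a * b \<in> C"
  shows "set_prod_sums A B \<subseteq> C"
proof
  fix z assume "z \<in> set_prod_sums A B"
  then show "z \<in> C" by (induction rule: set_prod_sums_induct) (auto intro: assms)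
qed

lemma set_prod_sums_mono: "A \<subseteq> A' \<Longrightarrow> B \<subseteq> B' \<Longrightarrow> set_prod_sums A B \<subseteq> set_prod_sums A' B'"
  by (rule set_prod_sums_least) (auto intro: set_prod_sums_zero set_prod_sums_add set_prod_sums_mult)

lemma subset_set_prod_sums: "subring D \<Longrightarrow> B \<subseteq> set_prod_sums D B"
  using set_prod_sums_mult[OF subringD(2)] by fastforce

lemma set_prod_sums_scale:
  assumes "subring D" "d \<in> D" "z \<in> set_prod_sums D B"
  shows "d * z \<in> set_prod_sums D B"
  using assms(3)
proof (induction rule: set_prod_sums_induct)
  case zero
  then show ?case by (simp add: set_prod_sums_zero)
next
  case (mult a b)
  then show ?case
    using set_prod_sums_mult[OF subringD(5)[OF assms(1,2) mult(1)] mult(2)] by (simp add: mult.assoc)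
next
  case (add u v)
  then show ?case by (simp add: distrib_left set_prod_sums_add)
qed

lemma ideal_generated:
  assumes "subring D" "B \<subseteq> D"
  shows "ideal_of (set_prod_sums D B) D"
  unfolding ideal_of_def
proof (intro conjI ballI)
  show "set_prod_sums D B \<subseteq> D"
    by (rule set_prod_sums_least) (use assms in \<open>auto intro: subringD\<close>)
  show "- z \<in> set_prod_sums D B" if "z \<in> set_prod_sums D B" for z
    using set_prod_sums_scale[OF assms(1) subring_uminus[OF assms(1) subringD(2)[OF assms(1)]] that]
    by simp
qed (auto intro: set_prod_sums_zero set_prod_sums_add set_prod_sums_scale[OF assms(1)])

lemma ideal_generated_least: "ideal_of I D \<Longrightarrow> B \<subseteq> I \<Longrightarrow> set_prod_sums D B \<subseteq> I"
  by (rule set_prod_sums_least) (auto intro: idealD)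

lemma subring_endo_ring: "ideal_of I D \<Longrightarrow> subring (endo_ring I)"
  unfolding subring_def endo_ring_def
  by (auto simp: distrib_right left_diff_distrib mult.assoc intro: idealD ideal_diff)

lemma subset_endo_ring: "ideal_of I D \<Longrightarrow> D \<subseteq> endo_ring I"
  unfolding endo_ring_def by (auto intro: idealD)

subsection \<open>Maximal ideals\<close>

text \<open>Stated as a partition of unity with no ambient ring, so that it survives enlarging both
  the ideals and the ring, as in the passage from \<open>I n\<close> to \<open>J n\<close>
  below.\<close>

definition comaximal :: "'a::field set \<Rightarrow> 'a set \<Rightarrow> bool" where
  "comaximal I J \<longleftrightarrow> (\<exists>a\<in>I. \<exists>b\<in>J. a + b = 1)"

lemma comaximal_sym: "comaximal I J \<Longrightarrow> comaximal J I"
  unfolding comaximal_def by (metis add.commute)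

lemma comaximal_mono: "comaximal I J \<Longrightarrow> I \<subseteq> I' \<Longrightarrow> J \<subseteq> J' \<Longrightarrow> comaximal I' J'"
  unfolding comaximal_def by blast

lemma ideal_sum:
  assumes I: "ideal_of I D" and J: "ideal_of J D" and D: "subring D"
  shows "ideal_of {a + b | a b. a \<in> I \<and> b \<in> J} D" (is "ideal_of ?S D")
  unfolding ideal_of_def
proof (intro conjI ballI)
  show "?S \<subseteq> D" using idealD(1)[OF I] idealD(1)[OF J] subringD(3)[OF D] by auto
  show "0 \<in> ?S" using idealD(2)[OF I] idealD(2)[OF J] by force
next
  fix u v assume "u \<in> ?S" "v \<in> ?S"
  then obtain a b c d where "a \<in> I" "b \<in> J" "c \<in> I" "d \<in> J" "u = a + b" "v = c + d" by blast
  then have "u + v = (a + c) + (b + d)" "a + c \<in> I" "b + d \<in> J"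
    by (simp_all add: idealD(3)[OF I] idealD(3)[OF J])
  then show "u + v \<in> ?S" by blast
next
  fix u assume "u \<in> ?S"
  then obtain a b where "a \<in> I" "b \<in> J" "u = a + b" by blast
  then have "- u = (- a) + (- b)" "- a \<in> I" "- b \<in> J"
    by (simp_all add: idealD(4)[OF I] idealD(4)[OF J])
  then show "- u \<in> ?S" by blast
next
  fix d u assume "d \<in> D" "u \<in> ?S"
  then obtain a b where "a \<in> I" "b \<in> J" "u = a + b" by blast
  then have "d * u = d * a + d * b" "d * a \<in> I" "d * b \<in> J"
    using \<open>d \<in> D\<close> by (simp_all add: distrib_left idealD(5)[OF I] idealD(5)[OF J])
  then show "d * u \<in> ?S" by blast
qed

lemma maximal_ideal_one:
  assumes "maximal_ideal_of M D"
  shows "1 \<notin> M"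
  using assms ideal_one unfolding maximal_ideal_of_def by blast

text \<open>The sum of \<open>M\<close> and \<open>J\<close> is an ideal strictly larger than
  \<open>M\<close>, hence all of \<open>D\<close>.\<close>

lemma maximal_comaximal:
  assumes D: "subring D" and M: "maximal_ideal_of M D" and J: "ideal_of J D" and "\<not> J \<subseteq> M"
  shows "comaximal M J"
proof -
  define S where "S = {a + b | a b. a \<in> M \<and> b \<in> J}"
  have MI: "ideal_of M D" using M by (simp add: maximal_ideal_of_def)
  have "M \<subseteq> S" using idealD(2)[OF J] unfolding S_def by force
  moreover have "J \<subseteq> S" using idealD(2)[OF MI] unfolding S_def by force
  moreover have "ideal_of S D" unfolding S_def by (rule ideal_sum[OF MI J D])
  ultimately have "S = D"
    using M \<open>\<not> J \<subseteq> M\<close> unfolding maximal_ideal_of_def by blast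
  then have "1 \<in> S" using subringD(2)[OF D] by simp
  then show ?thesis unfolding comaximal_def S_def by force
qed

text \<open>Write \<open>1 = a + b\<close> with \<open>a\<close> in \<open>M\<close> and
  \<open>b\<close> a multiple of \<open>s\<close>; then \<open>t = t * a + t * b\<close>, and
  \<open>t * b\<close> is a multiple of \<open>s * t\<close>.\<close>

lemma maximal_ideal_prime:
  assumes D: "subring D" and M: "maximal_ideal_of M D"
    and "s \<in> D" "t \<in> D" "s * t \<in> M" "s \<notin> M"
  shows "t \<in> M"
proof -
  have MI: "ideal_of M D" using M by (simp add: maximal_ideal_of_def)
  have "\<not> set_prod_sums D {s} \<subseteq> M" using subset_set_prod_sums[OF D, of "{s}"] \<open>s \<notin> M\<close> by blast
  then obtain a b where ab: "a \<in> M" "b \<in> set_prod_sums D {s}" "a + b = 1"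
    using maximal_comaximal[OF D M ideal_generated[OF D]] \<open>s \<in> D\<close> unfolding comaximal_def by blast
  from ab(2) have "t * b \<in> M"
  proof (induction rule: set_prod_sums_induct)
    case zero
    then show ?case using idealD(2)[OF MI] by simp
  next
    case (mult d s')
    then have "t * (d * s') = d * (s * t)" by simp
    then show ?case using idealD(5)[OF MI mult(1) assms(5)] by (simp only:)
  next
    case (add u v)
    then show ?case by (simp add: distrib_left idealD(3)[OF MI])
  qed
  moreover have "t * a \<in> M" using idealD(5)[OF MI] ab(1) \<open>t \<in> D\<close> by blast
  ultimately have "t * a + t * b \<in> M" by (rule idealD(3)[OF MI, rotated])
  then show ?thesis using ab(3) by (simp flip: distrib_left)
qed

lemma maximal_ideal_exists:
  assumes I: "ideal_of I D" and one: "1 \<in> D" "1 \<notin> I"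
  obtains M where "maximal_ideal_of M D" "I \<subseteq> M"
proof -
  \<comment> \<open>Properness is expressed by \<open>1 \<notin> J\<close>, a condition that passes
    to unions of chains.\<close>
  define P where "P = {J. ideal_of J D \<and> I \<subseteq> J \<and> 1 \<notin> J}"
  have "\<exists>M\<in>P. \<forall>J\<in>P. M \<subseteq> J \<longrightarrow> J = M"
  proof (rule subset_Zorn_nonempty)
    show "P \<noteq> {}" using I one P_def by blast
    fix C assume C: "C \<noteq> {}" "subset.chain P C"
    have id: "ideal_of J D" if "J \<in> C" for J using that C(2) by (auto simp: P_def subset.chain_def)
    have ch: "J \<subseteq> J' \<or> J' \<subseteq> J" if "J \<in> C" "J' \<in> C" for J J'
      using that C(2) by (auto simp: subset.chain_def)
    have "ideal_of (\<Union>C) D" unfolding ideal_of_def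
    proof (intro conjI ballI)
      fix u v assume "u \<in> \<Union>C" "v \<in> \<Union>C"
      then obtain J where "J \<in> C" "u \<in> J" "v \<in> J" using ch by blast
      then show "u + v \<in> \<Union>C" using idealD(3)[OF id] by blast
    qed (use C(1) id in \<open>auto dest: idealD\<close>)
    moreover have "I \<subseteq> \<Union>C" "1 \<notin> \<Union>C"
      using C unfolding P_def subset.chain_def by blast+
    ultimately show "\<Union>C \<in> P" by (simp add: P_def)
  qed
  then obtain M where M: "M \<in> P" "\<And>J. J \<in> P \<Longrightarrow> M \<subseteq> J \<Longrightarrow> J = M" by blast
  have "maximal_ideal_of M D" unfolding maximal_ideal_of_def
  proof (intro conjI allI impI)
    show "ideal_of M D" "M \<noteq> D" using M(1) one by (auto simp: P_def)
    fix J assume J: "ideal_of J D \<and> M \<subseteq> J"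
    show "J = M \<or> J = D"
      using ideal_one J M unfolding P_def by (cases "1 \<in> J") blast+
  qed
  then show ?thesis using that M(1) by (auto simp: P_def)
qed

section \<open>Localization at a maximal ideal\<close>

lemma subset_localization:
  assumes "subring D" "maximal_ideal_of M D"
  shows "D \<subseteq> localization D M"
proof
  fix x assume "x \<in> D"
  then have "x = x / 1 \<and> x \<in> D \<and> 1 \<in> D \<and> 1 \<notin> M"
    using subringD(2)[OF assms(1)] maximal_ideal_one[OF assms(2)] by simp
  then show "x \<in> localization D M" unfolding localization_def by blast
qed

lemma subring_localization:
  assumes D: "subring D" and M: "maximal_ideal_of M D"
  shows "subring (localization D M)"
  unfolding subring_def
proof (intro conjI ballI)
  show "0 \<in> localization D M" "1 \<in> localization D M"
    using subset_localization[OF D M] subringD[OF D] by auto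
  fix u v assume "u \<in> localization D M" "v \<in> localization D M"
  then obtain a s b t where u: "u = a / s" "a \<in> D" "s \<in> D" "s \<notin> M"
    and v: "v = b / t" "b \<in> D" "t \<in> D" "t \<notin> M"
    unfolding localization_def by blast
  have "0 \<in> M" using M by (auto simp: maximal_ideal_of_def ideal_of_def)
  then have nz: "s \<noteq> 0" "t \<noteq> 0" using u v by auto
  have st: "s * t \<in> D" "s * t \<notin> M"
    using u v maximal_ideal_prime[OF D M] subringD(5)[OF D] by blast+
  have loc: "c / (s * t) \<in> localization D M" if "c \<in> D" for c
    using that st unfolding localization_def by blast
  have "u + v = (a * t + b * s) / (s * t)" "u - v = (a * t - b * s) / (s * t)"
    "u * v = (a * b) / (s * t)"
    using u v nz by (simp_all add: add_frac_eq diff_frac_eq)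
  then show "u + v \<in> localization D M" "u - v \<in> localization D M" "u * v \<in> localization D M"
    using loc u v subringD[OF D] by auto
qed

subsection \<open>Comaximal invertible ideals of LPI-domains\<close>

text \<open>The contradiction is an \<open>n\<close> with both \<open>e\<close> and
  \<open>1 - e\<close> in \<open>J n\<close>. Finite generation of the invertible ideal
  \<open>A\<close> is not extracted; the equation \<open>A (D : A) = D\<close> is used directly,
  through a property of its elements that holds for all large \<open>n\<close>.\<close>

lemma LPI_no_comaximal_invertible_sequence:
  fixes J :: "nat \<Rightarrow> 'a::field set"
  assumes D: "subring D" and LPI: "LPI_domain D"
    and J: "\<And>n. ideal_of (J n) D" and proper: "\<And>n. 1 \<notin> J n"
    and inv: "\<And>n. 1 \<in> set_prod_sums (J n) (colon D (J n))"
    and comax: "\<And>m n. m \<noteq> n \<Longrightarrow> comaximal (J m) (J n)"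
    and x: "x \<noteq> 0" "\<And>n. x \<in> J n"
  shows False
proof -
  \<comment> \<open>The factor \<open>x\<close>, common to all \<open>J n\<close>, moves every
    inverse \<open>(D : J n)\<close> into \<open>D\<close>.\<close>
  define U where "U = (\<Union>n. (*) x ` colon D (J n))"
  define A where "A = set_prod_sums D U"
  have colon_mem: "y * j \<in> D" "j * y \<in> D" if "y \<in> colon D (J n)" "j \<in> J n" for y j n
    using that unfolding colon_def by (auto simp: mult.commute)
  have colon_one: "1 \<in> colon D (J n)" for n using idealD(1)[OF J] unfolding colon_def by auto
  have UD: "U \<subseteq> D" unfolding U_def using colon_mem(2)[OF _ x(2)] by auto
  have A: "ideal_of A D" unfolding A_def by (rule ideal_generated[OF D UD])
  have UA: "U \<subseteq> A" unfolding A_def by (rule subset_set_prod_sums[OF D])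
  have "x \<in> U" unfolding U_def using colon_one by force
  then have "A \<noteq> {0}" using UA x(1) by blast
  moreover have "locally_principal A D" unfolding locally_principal_def
  proof (intro allI impI)
    fix M assume M: "maximal_ideal_of M D"
    let ?S = "localization D M"
    have MI: "ideal_of M D" using M by (simp add: maximal_ideal_of_def)
    have S: "subring ?S" and DS: "D \<subseteq> ?S"
      using subring_localization[OF D M] subset_localization[OF D M] .
    \<comment> \<open>An element \<open>u\<close> of \<open>J k\<close> outside \<open>M\<close> is
      a unit of the localization and clears the denominator of \<open>z\<close>.\<close>
    have off: "z \<in> ?S" if z: "z \<in> colon D (J k)" "\<not> J k \<subseteq> M" for z k
    proof -
      obtain u where u: "u \<in> J k" "u \<notin> M" using z(2) by blast
      then have "z = (z * u) / u" using idealD(2)[OF MI] by auto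
      then show ?thesis
        using u colon_mem(1)[OF z(1) u(1)] idealD(1)[OF J] unfolding localization_def by blast
    qed
    \<comment> \<open>A single \<open>y\<close> must generate all the inverses over the localization
      at once. If \<open>M\<close> contains no \<open>J n\<close>, then \<open>y = 1\<close>
      works.\<close>
    obtain n y where y: "y \<in> colon D (J n)"
      and gen: "\<And>k z. z \<in> colon D (J k) \<Longrightarrow> \<exists>s\<in>?S. z = y * s"
    proof (cases "\<exists>n. J n \<subseteq> M")
      case False
      then show ?thesis using that[OF colon_one] off by simp
    next
      case True
      then obtain n where n: "J n \<subseteq> M" by blast
      \<comment> \<open>By invertibility \<open>1\<close> is a sum of products \<open>j * y\<close>,
        so they cannot all lie in \<open>M\<close>. A product outside \<open>M\<close> is a unit of
        the localization.\<close>
      have "\<exists>j\<in>J n. \<exists>y\<in>colon D (J n). j * y \<notin> M"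
      proof (rule ccontr)
        assume "\<not> ?thesis"
        then have "set_prod_sums (J n) (colon D (J n)) \<subseteq> M"
          by (intro set_prod_sums_least) (auto intro: idealD[OF MI])
        then show False using inv maximal_ideal_one[OF M] by blast
      qed
      then obtain j y where jy: "j \<in> J n" "y \<in> colon D (J n)" "j * y \<notin> M" by blast
      have nz: "j * y \<noteq> 0" using jy(3) idealD(2)[OF MI] by auto
      have frac: "d / (j * y) \<in> ?S" if "d \<in> D" for d
        using that jy(3) colon_mem(2)[OF jy(2,1)] unfolding localization_def by blast
      have "\<exists>s\<in>?S. z = y * s" if z: "z \<in> colon D (J k)" for k z
      proof (cases "k = n")
        case True
        then have "z = y * ((z * j) / (j * y))" "z * j \<in> D"
          using nz colon_mem(1)[of z n j] z jy(1) by auto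
        then show ?thesis using frac by blast
      next
        case False
        have "\<not> J k \<subseteq> M"
        proof
          assume "J k \<subseteq> M"
          then have "1 \<in> M"
            using comax[OF False] n idealD(3)[OF MI] unfolding comaximal_def by (metis subsetD)
          then show False using maximal_ideal_one[OF M] by simp
        qed
        then have zS: "z \<in> ?S" using off z by blast
        \<comment> \<open>Here \<open>z\<close> is already in the localization, and \<open>y\<close>
          divides \<open>1\<close> there with quotient \<open>j / (j * y)\<close>.\<close>
        have "z = y * (z * (j / (j * y)))" using nz by simp
        then show ?thesis using subringD(5)[OF S zS frac] jy(1) idealD(1)[OF J] by blast
      qed
      then show ?thesis using that[OF jy(2)] by blast
    qed
    define a where "a = x * y"
    have aU: "a \<in> U" using y unfolding a_def U_def by blast
    have closed: "u + v \<in> {a * s |s. s \<in> ?S}"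
      if uv: "u \<in> {a * s |s. s \<in> ?S}" "v \<in> {a * s |s. s \<in> ?S}" for u v
    proof -
      obtain s t where "s \<in> ?S" "t \<in> ?S" "u = a * s" "v = a * t" using uv by blast
      then have "u + v = a * (s + t)" "s + t \<in> ?S" using subringD(3)[OF S] by (auto simp: distrib_left)
      then show ?thesis by blast
    qed
    have scale: "v * s \<in> {a * s |s. s \<in> ?S}" if v: "v \<in> {a * s |s. s \<in> ?S}" and s: "s \<in> ?S" for v s
    proof -
      obtain t where "t \<in> ?S" "v = a * t" using v by blast
      then have "v * s = a * (t * s)" "t * s \<in> ?S" using subringD(5)[OF S] s by auto
      then show ?thesis by blast
    qed
    have zero: "0 \<in> {a * s |s. s \<in> ?S}" using subringD(1)[OF S] by force
    have U_sub: "U \<subseteq> {a * s |s. s \<in> ?S}"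
    proof
      fix u assume "u \<in> U"
      then obtain k z where "z \<in> colon D (J k)" "u = x * z" unfolding U_def by blast
      then obtain s where "s \<in> ?S" "u = a * s" using gen a_def by (metis mult.assoc)
      then show "u \<in> {a * s |s. s \<in> ?S}" by blast
    qed
    have A_sub: "A \<subseteq> {a * s |s. s \<in> ?S}" unfolding A_def
    proof (rule set_prod_sums_least[OF zero closed])
      fix d u assume "d \<in> D" "u \<in> U"
      then show "d * u \<in> {a * s |s. s \<in> ?S}"
        using scale[of u d] U_sub DS by (auto simp: mult.commute)
    qed
    have "set_prod_sums A ?S = {a * s |s. s \<in> ?S}"
    proof
      show "set_prod_sums A ?S \<subseteq> {a * s |s. s \<in> ?S}"
        by (rule set_prod_sums_least[OF zero closed]) (use scale A_sub in blast)+
      show "{a * s |s. s \<in> ?S} \<subseteq> set_prod_sums A ?S"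
        using set_prod_sums_mult aU UA by blast
    qed
    then show "principal_ideal_of (set_prod_sums A ?S) ?S"
      unfolding principal_ideal_of_def using aU UD DS by blast
  qed
  ultimately have A_inv: "set_prod_sums A (colon D A) = D"
    using LPI A unfolding LPI_domain_def invertible_ideal_def by blast
  \<comment> \<open>An element of \<open>A\<close> involves finitely many inverses
    \<open>(D : J k)\<close>. For \<open>n\<close> beyond these \<open>k\<close>, comaximality gives
    multipliers in \<open>J k\<close> that are 1 modulo \<open>J n\<close>; their product clears all
    denominators.\<close>
  have A_fin: "\<exists>N. \<forall>n\<ge>N. \<exists>e\<in>D. 1 - e \<in> J n \<and> e * a \<in> (*) x ` D" if "a \<in> A" for a
    using that unfolding A_def
  proof (induction rule: set_prod_sums_induct)
    case zero
    show ?case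
      using subringD[OF D] idealD(2)[OF J] by (intro exI[of _ 0] allI impI bexI[of _ 1]) auto
  next
    case (mult d u)
    then obtain k z where z: "z \<in> colon D (J k)" "u = x * z" unfolding U_def by blast
    have "\<exists>e\<in>D. 1 - e \<in> J n \<and> e * (d * u) \<in> (*) x ` D" if "n \<ge> Suc k" for n
    proof -
      have "k \<noteq> n" using that by simp
      from comax[OF this] obtain e b where e: "e \<in> J k" "b \<in> J n" "e + b = 1"
        unfolding comaximal_def by blast
      have "e * (d * u) = x * (d * (e * z))" using z(2) by simp
      moreover have "d * (e * z) \<in> D" using subringD(5)[OF D mult(1)] colon_mem(2)[OF z(1) e(1)] .
      moreover have "1 - e = b" using e(3) by (auto simp: algebra_simps)
      ultimately show ?thesis using e(1,2) idealD(1)[OF J] by blast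
    qed
    then show ?case by blast
  next
    case (add u v)
    then obtain N N' where N: "\<forall>n\<ge>N. \<exists>e\<in>D. 1 - e \<in> J n \<and> e * u \<in> (*) x ` D"
      and N': "\<forall>n\<ge>N'. \<exists>e\<in>D. 1 - e \<in> J n \<and> e * v \<in> (*) x ` D" by blast
    have "\<exists>e\<in>D. 1 - e \<in> J n \<and> e * (u + v) \<in> (*) x ` D" if n: "n \<ge> max N N'" for n
    proof -
      obtain e c where e: "e \<in> D" "1 - e \<in> J n" "e * u = x * c" "c \<in> D" using N n by force
      obtain f c' where f: "f \<in> D" "1 - f \<in> J n" "f * v = x * c'" "c' \<in> D" using N' n by force
      \<comment> \<open>Elements that are 1 modulo \<open>J n\<close> are closed under products, so
        one multiplier serves both summands.\<close>
      have "1 - e * f = (1 - e) + e * (1 - f)" by (simp add: algebra_simps)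
      then have "1 - e * f \<in> J n" using idealD(3,5)[OF J] e f by metis
      moreover have "(e * f) * (u + v) = x * (f * c + e * c')"
      proof -
        have "(e * f) * (u + v) = f * (e * u) + e * (f * v)" by (simp add: algebra_simps)
        then show ?thesis unfolding e(3) f(3) by (simp add: algebra_simps)
      qed
      moreover have "f * c + e * c' \<in> D" "e * f \<in> D" using e f by (auto intro: subringD[OF D])
      ultimately show ?thesis by blast
    qed
    then show ?case by blast
  qed
  \<comment> \<open>The multiplier and the bound are now uniform over all \<open>z\<close> in
    \<open>A\<close>: for \<open>c = a * b\<close> with \<open>b\<close> in \<open>(D : A)\<close>,
    it suffices to treat \<open>a\<close>, since \<open>b * z\<close> lies in
    \<open>D\<close>.\<close>
  have "\<exists>N. \<forall>n\<ge>N. \<exists>e\<in>D. 1 - e \<in> J n \<and> (\<forall>z\<in>A. e * c * z \<in> (*) x ` D)"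
    if "c \<in> set_prod_sums A (colon D A)" for c
    using that
  proof (induction rule: set_prod_sums_induct)
    case zero
    show ?case
      using subringD[OF D] idealD(2)[OF J] by (intro exI[of _ 0] allI impI bexI[of _ 1]) auto
  next
    case (mult a b)
    obtain N where N: "\<forall>n\<ge>N. \<exists>e\<in>D. 1 - e \<in> J n \<and> e * a \<in> (*) x ` D"
      using A_fin[OF mult(1)] by blast
    have "\<exists>e\<in>D. 1 - e \<in> J n \<and> (\<forall>z\<in>A. e * (a * b) * z \<in> (*) x ` D)" if n: "n \<ge> N" for n
    proof -
      obtain e c where e: "e \<in> D" "1 - e \<in> J n" "e * a = x * c" "c \<in> D" using N n by force
      have "e * (a * b) * z \<in> (*) x ` D" if z: "z \<in> A" for z
      proof -
        have "e * (a * b) * z = x * (c * (b * z))" using e(3) by (simp flip: mult.assoc)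
        moreover have "c * (b * z) \<in> D"
          using subringD(5)[OF D e(4)] mult(2) z unfolding colon_def by blast
        ultimately show ?thesis by blast
      qed
      then show ?thesis using e by blast
    qed
    then show ?case by blast
  next
    case (add u v)
    then obtain N N' where N: "\<forall>n\<ge>N. \<exists>e\<in>D. 1 - e \<in> J n \<and> (\<forall>z\<in>A. e * u * z \<in> (*) x ` D)"
      and N': "\<forall>n\<ge>N'. \<exists>e\<in>D. 1 - e \<in> J n \<and> (\<forall>z\<in>A. e * v * z \<in> (*) x ` D)" by blast
    have "\<exists>e\<in>D. 1 - e \<in> J n \<and> (\<forall>z\<in>A. e * (u + v) * z \<in> (*) x ` D)" if n: "n \<ge> max N N'" for n
    proof -
      obtain e where e: "e \<in> D" "1 - e \<in> J n" "\<forall>z\<in>A. e * u * z \<in> (*) x ` D" using N n by force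
      obtain f where f: "f \<in> D" "1 - f \<in> J n" "\<forall>z\<in>A. f * v * z \<in> (*) x ` D" using N' n by force
      have "1 - e * f = (1 - e) + e * (1 - f)" by (simp add: algebra_simps)
      then have "1 - e * f \<in> J n" using idealD(3,5)[OF J] e f by metis
      moreover have "(e * f) * (u + v) * z \<in> (*) x ` D" if z: "z \<in> A" for z
      proof -
        obtain c where c: "c \<in> D" "e * u * z = x * c" using e(3) z by blast
        obtain c' where c': "c' \<in> D" "f * v * z = x * c'" using f(3) z by blast
        have "(e * f) * (u + v) * z = f * (e * u * z) + e * (f * v * z)"
          by (simp add: algebra_simps)
        also have "\<dots> = x * (f * c + e * c')" unfolding c(2) c'(2) by (simp add: algebra_simps)
        finally show ?thesis using c c' e f by (auto intro: subringD[OF D])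
      qed
      ultimately show ?thesis using e f subringD(5)[OF D] by blast
    qed
    then show ?case by blast
  qed
  from this[of 1] obtain n e where e: "e \<in> D" "1 - e \<in> J n" "\<forall>z\<in>A. e * z \<in> (*) x ` D"
    using A_inv subringD(2)[OF D] by auto
  \<comment> \<open>Since \<open>e A\<close> lies in \<open>x D\<close> and \<open>A\<close>
    contains \<open>x (D : J n)\<close>, \<open>e\<close> maps \<open>(D : J n)\<close> into
    \<open>D\<close>; hence it maps \<open>J n (D : J n)\<close> into \<open>J n\<close>. Applied to
    \<open>1\<close>, this puts \<open>e\<close> in \<open>J n\<close>.\<close>
  have "e * c \<in> J n" if "c \<in> set_prod_sums (J n) (colon D (J n))" for c
    using that
  proof (induction rule: set_prod_sums_induct)
    case zero
    then show ?case using idealD(2)[OF J] by simp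
  next
    case (mult j y)
    then have "x * y \<in> A" using UA unfolding U_def by blast
    then have "x * (e * y) \<in> (*) x ` D" using e(3) by (metis mult.left_commute)
    then have "e * y \<in> D" using x(1) by auto
    then have "(e * y) * j \<in> J n" using idealD(5)[OF J] mult(1) by blast
    then show ?case by (simp add: mult_ac)
  next
    case (add u v)
    then show ?case by (simp add: distrib_left idealD(3)[OF J])
  qed
  from this[OF inv] have "e \<in> J n" by simp
  then have "1 \<in> J n" using idealD(3)[OF J _ e(2)] by fastforce
  then show False using proper by blast
qed

subsection \<open>Comaximal stable ideals\<close>

text \<open>Stability makes each \<open>I n\<close> invertible over its own ring
  \<open>E(I n)\<close> only; the ring \<open>T\<close> is a common base to which the preceding
  lemma applies.\<close>

lemma no_comaximal_stable_sequence:
  fixes I :: "nat \<Rightarrow> 'a::field set"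
  assumes R: "subring R" and LPI: "\<And>D. fractional_overring R D \<Longrightarrow> LPI_domain D"
    and I: "\<And>n. ideal_of (I n) R" and proper: "\<And>n. 1 \<notin> I n"
    and stable: "\<And>n. stable_ideal (I n)"
    and comax: "\<And>m n. m \<noteq> n \<Longrightarrow> comaximal (I m) (I n)"
    and x: "x \<noteq> 0" "\<And>n. x \<in> I n"
  shows False
proof -
  define E where "E = (\<lambda>n. endo_ring (I n))"
  define T where "T = set_prod_sums R (\<Union>n. E n)"
  define J where "J = (\<lambda>n. set_prod_sums T (I n))"
  have E: "subring (E n)" "R \<subseteq> E n" for n
    unfolding E_def using subring_endo_ring[OF I] subset_endo_ring[OF I] .
  have EI: "u * i \<in> I n" if "u \<in> E n" "i \<in> I n" for u i n
    using that unfolding E_def endo_ring_def by blast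
  have ET: "E n \<subseteq> T" for n
    using subset_set_prod_sums[OF R, of "\<Union>n. E n"] unfolding T_def by blast
  have RT: "R \<subseteq> T" using E(2) ET by blast
  have RE_T: "r * u \<in> E n" if "r \<in> R" "u \<in> E n" for r u n
    using that E subringD(5) by blast
  have T_add: "u + v \<in> T" if "u \<in> T" "v \<in> T" for u v
    using that set_prod_sums_add unfolding T_def by blast
  have T_scale: "r * v \<in> T" if "r \<in> R" "v \<in> T" for r v
    using that set_prod_sums_scale[OF R] unfolding T_def by blast
  \<comment> \<open>With \<open>1 = a + b\<close>, both \<open>u * a\<close> and
    \<open>v * b\<close> lie in \<open>R\<close>, so the product \<open>u * v\<close> is an
    \<open>R\<close>-combination of \<open>v\<close> and \<open>u\<close>.\<close>
  have EE_T: "u * v \<in> T" if "u \<in> E k" "v \<in> E l" for u v k l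
  proof (cases "k = l")
    case True
    then show ?thesis using that subringD(5)[OF E(1)] ET by blast
  next
    case False
    from comax[OF this] obtain a b where ab: "a \<in> I k" "b \<in> I l" "a + b = 1"
      unfolding comaximal_def by blast
    have "u * v = u * v * (a + b)" using ab(3) by simp
    also have "\<dots> = (u * a) * v + (v * b) * u" by (simp add: algebra_simps)
    finally show ?thesis
      using T_add RE_T that EI ab(1,2) idealD(1)[OF I] ET by (metis subsetD)
  qed
  have TE_T: "t * u \<in> T" if "t \<in> T" "u \<in> E n" for t u n
    using that(1) unfolding T_def
  proof (induction rule: set_prod_sums_induct)
    case zero
    then show ?case by (simp add: set_prod_sums_zero)
  next
    case (mult r v)
    then show ?case using T_scale[OF mult(1)] EE_T that(2) unfolding T_def by (auto simp: mult.assoc)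
  next
    case (add v w)
    then show ?case using T_add unfolding T_def by (simp add: distrib_right)
  qed
  have T_mult: "t * u \<in> T" if "u \<in> T" "t \<in> T" for t u
    using that(1) unfolding T_def
  proof (induction rule: set_prod_sums_induct)
    case zero
    then show ?case by (simp add: set_prod_sums_zero)
  next
    case (mult r v)
    then show ?case using T_scale[OF mult(1)] TE_T that(2) unfolding T_def
      by (auto simp: mult.left_commute)
  next
    case (add v w)
    then show ?case using T_add unfolding T_def by (simp add: distrib_left)
  qed
  have "- 1 \<in> R" using subring_uminus[OF R subringD(2)[OF R]] .
  then have T_diff: "u - v \<in> T" if "u \<in> T" "v \<in> T" for u v
    using T_add[OF that(1) T_scale[OF _ that(2), of "- 1"]] by simp
  have T: "subring T"
    unfolding subring_def
    by (intro conjI ballI T_add T_diff T_mult subsetD[OF RT subringD(1)[OF R]]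
        subsetD[OF RT subringD(2)[OF R]])
  \<comment> \<open>\<open>x\<close> lies in every \<open>I n\<close>, and \<open>E n\<close> maps
    \<open>I n\<close> into itself, hence into \<open>R\<close>.\<close>
  have xT: "x * t \<in> R" if "t \<in> T" for t
    using that unfolding T_def
  proof (induction rule: set_prod_sums_induct)
    case zero
    then show ?case using subringD(1)[OF R] by simp
  next
    case (mult r v)
    then obtain n where "v \<in> E n" by blast
    then have "v * x \<in> R" using EI x(2) idealD(1)[OF I] by blast
    then have "r * (v * x) \<in> R" using subringD(5)[OF R mult(1)] by blast
    then show ?case by (simp add: mult_ac)
  next
    case (add v w)
    then show ?case using subringD(3)[OF R] by (simp add: distrib_left)
  qed
  have "x \<in> R" using x(2) idealD(1)[OF I] by blast
  then have "fractional_overring R T"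
    unfolding fractional_overring_def overring_def using T RT xT x(1) by blast
  then have T_LPI: "LPI_domain T" by (rule LPI)
  have IT: "I n \<subseteq> T" for n using idealD(1)[OF I] RT by blast
  have IJ: "I n \<subseteq> J n" for n unfolding J_def by (rule subset_set_prod_sums[OF T])
  have J: "ideal_of (J n) T" for n unfolding J_def by (rule ideal_generated[OF T IT])
  have one_e: "1 - e * f \<in> I n" if "e \<in> R" "1 - e \<in> I n" "1 - f \<in> I n" for e f n
  proof -
    have "1 - e * f = (1 - e) + e * (1 - f)" by (simp add: algebra_simps)
    then show ?thesis using idealD(3,5)[OF I] that by metis
  qed
  \<comment> \<open>Up to a multiplier that is 1 modulo \<open>I n\<close>, \<open>T\<close> is no
    larger than \<open>E n\<close>: for \<open>k\<close> other than \<open>n\<close>, an element of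
    \<open>I k\<close> sends \<open>E k\<close> into \<open>R\<close>.\<close>
  have T_local: "\<exists>e\<in>R. 1 - e \<in> I n \<and> e * t \<in> E n" if "t \<in> T" for t n
    using that unfolding T_def
  proof (induction rule: set_prod_sums_induct)
    case zero
    show ?case using subringD[OF R] idealD(2)[OF I] subringD(1)[OF E(1)]
      by (intro bexI[of _ 1]) auto
  next
    case (mult r v)
    then obtain k where v: "v \<in> E k" by blast
    show ?case
    proof (cases "k = n")
      case True
      then show ?thesis using v RE_T mult(1) subringD[OF R] idealD(2)[OF I]
        by (intro bexI[of _ 1]) auto
    next
      case False
      from comax[OF this] obtain e b where e: "e \<in> I k" "b \<in> I n" "e + b = 1"
        unfolding comaximal_def by blast
      have "v * e \<in> R" using EI[OF v e(1)] idealD(1)[OF I] by blast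
      then have "r * (v * e) \<in> E n" using subringD(5)[OF R mult(1)] E(2) by blast
      moreover have "1 - e = b" using e(3) by (auto simp: algebra_simps)
      ultimately show ?thesis
        using e idealD(1)[OF I] by (intro bexI[of _ e]) (auto simp: mult_ac dest: subsetD)
    qed
  next
    case (add u v)
    then obtain e f where e: "e \<in> R" "1 - e \<in> I n" "e * u \<in> E n"
      and f: "f \<in> R" "1 - f \<in> I n" "f * v \<in> E n" by blast
    have "(e * f) * (u + v) = f * (e * u) + e * (f * v)" by (simp add: algebra_simps)
    moreover have "f * (e * u) + e * (f * v) \<in> E n" using RE_T e f subringD(3)[OF E(1)] by blast
    ultimately show ?case using one_e e f subringD(5)[OF R] by metis
  qed
  \<comment> \<open>Consequently \<open>J n\<close> is no larger than \<open>I n\<close> up to such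
    a multiplier. This keeps \<open>J n\<close> proper: if \<open>1\<close> were in
    \<open>J n\<close>, then \<open>e\<close> and \<open>1 - e\<close> would both be in
    \<open>I n\<close>.\<close>
  have J_local: "\<exists>e\<in>R. 1 - e \<in> I n \<and> e * z \<in> I n" if "z \<in> J n" for z n
    using that unfolding J_def
  proof (induction rule: set_prod_sums_induct)
    case zero
    show ?case using subringD[OF R] idealD(2)[OF I] by (intro bexI[of _ 1]) auto
  next
    case (mult t i)
    obtain e where e: "e \<in> R" "1 - e \<in> I n" "e * t \<in> E n" using T_local[OF mult(1)] by blast
    then have "(e * t) * i \<in> I n" using EI mult(2) by blast
    then show ?case using e by (auto simp: mult.assoc)
  next
    case (add u v)
    then obtain e f where e: "e \<in> R" "1 - e \<in> I n" "e * u \<in> I n"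
      and f: "f \<in> R" "1 - f \<in> I n" "f * v \<in> I n" by blast
    have "(e * f) * (u + v) = f * (e * u) + e * (f * v)" by (simp add: algebra_simps)
    moreover have "f * (e * u) + e * (f * v) \<in> I n" using e f idealD(3,5)[OF I] by blast
    ultimately show ?case using one_e e f subringD(5)[OF R] by metis
  qed
  show False
  proof (rule LPI_no_comaximal_invertible_sequence[OF T T_LPI J _ _ _ x(1)])
    fix n
    show "1 \<notin> J n"
    proof
      assume "1 \<in> J n"
      from J_local[OF this] obtain e where "1 - e \<in> I n" "e \<in> I n" by auto
      then have "1 \<in> I n" using idealD(3)[OF I] by fastforce
      then show False using proper by blast
    qed
    \<comment> \<open>This carries the relation witnessing stability over to \<open>T\<close>; it
      holds because \<open>J n\<close> is generated by \<open>I n\<close> and \<open>T\<close>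
      absorbs multiplication by \<open>E n\<close>.\<close>
    have "colon (E n) (I n) \<subseteq> colon T (J n)"
    proof
      fix y assume y: "y \<in> colon (E n) (I n)"
      have "y * z \<in> T" if "z \<in> J n" for z
        using that unfolding J_def
      proof (induction rule: set_prod_sums_induct)
        case zero
        then show ?case using subringD(1)[OF T] by simp
      next
        case (mult t i)
        then have "y * i \<in> E n" using y unfolding colon_def by blast
        then have "t * (y * i) \<in> T" using TE_T mult(1) by blast
        then show ?case by (simp add: mult_ac)
      next
        case (add u v)
        then show ?case using T_add by (simp add: distrib_left)
      qed
      then show "y \<in> colon T (J n)" unfolding colon_def by blast
    qed
    moreover have "1 \<in> set_prod_sums (I n) (colon (E n) (I n))"
      using stable subringD(2)[OF E(1)] unfolding stable_ideal_def invertible_ideal_def E_def by blast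
    ultimately show "1 \<in> set_prod_sums (J n) (colon T (J n))"
      using set_prod_sums_mono IJ by blast
    show "x \<in> J n" using x(2) IJ by blast
  next
    fix m n :: nat assume "m \<noteq> n"
    then show "comaximal (J m) (J n)" using comaximal_mono[OF comax IJ IJ] by blast
  qed
qed

subsection \<open>Comaximal finitely generated ideals above an element\<close>

lemma comaximal_fg_sequence:
  assumes R: "subring R" and x: "x \<in> R" and inf: "infinite {M. maximal_ideal_of M R \<and> x \<in> M}"
  obtains F :: "nat \<Rightarrow> 'a::field set"
  where "\<And>n. finite (F n)" "\<And>n. F n \<subseteq> R" "\<And>n. x \<in> F n" "\<And>n. 1 \<notin> set_prod_sums R (F n)"
    "\<And>m n. m \<noteq> n \<Longrightarrow> comaximal (set_prod_sums R (F m)) (set_prod_sums R (F n))"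
proof -
  let ?g = "set_prod_sums R"
  \<comment> \<open>\<open>V F\<close> is the closed set of the maximal spectrum cut out by
    \<open>F\<close>; disjointness of such sets detects comaximality.\<close>
  define V where "V F = {M. maximal_ideal_of M R \<and> F \<subseteq> M}" for F
  define ok where "ok F \<longleftrightarrow> finite F \<and> F \<subseteq> R \<and> x \<in> F \<and> 1 \<notin> ?g F" for F
  have max_ideal: "ideal_of M R" if "maximal_ideal_of M R" for M
    using that by (simp add: maximal_ideal_of_def)
  have V_g: "?g F \<subseteq> M" if "M \<in> V F" for F M
    using that ideal_generated_least max_ideal unfolding V_def by blast
  have V_one: "1 \<notin> ?g F" if "M \<in> V F" for F M
    using V_g[OF that] maximal_ideal_one that unfolding V_def by blast
  have V_ne: "V F \<noteq> {}" if "ok F" for F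
  proof -
    have "ideal_of (?g F) R" using that ideal_generated[OF R] unfolding ok_def by blast
    then obtain M where "maximal_ideal_of M R" "?g F \<subseteq> M"
      using maximal_ideal_exists subringD(2)[OF R] \<open>ok F\<close> unfolding ok_def by blast
    then show ?thesis using subset_set_prod_sums[OF R, of F] unfolding V_def by blast
  qed
  \<comment> \<open>Otherwise the sum of the two ideals is proper, and a maximal ideal above it lies
    in both closed sets.\<close>
  have sep: "comaximal (?g F) (?g G)" if "ok F" "ok G" "V F \<inter> V G = {}" for F G
  proof (rule ccontr)
    assume nc: "\<not> ?thesis"
    have id: "ideal_of (?g F) R" "ideal_of (?g G) R"
      using that ideal_generated[OF R] unfolding ok_def by blast+
    define S where "S = {a + b |a b. a \<in> ?g F \<and> b \<in> ?g G}"
    have "1 \<notin> S" using nc unfolding comaximal_def S_def by force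
    then obtain M where M: "maximal_ideal_of M R" "S \<subseteq> M"
      using maximal_ideal_exists[OF ideal_sum[OF id R, folded S_def] subringD(2)[OF R]] by blast
    have "?g F \<subseteq> S" using set_prod_sums_zero[of R G] unfolding S_def by force
    moreover have "?g G \<subseteq> S" using set_prod_sums_zero[of R F] unfolding S_def by force
    ultimately have "M \<in> V F \<inter> V G"
      using M subset_set_prod_sums[OF R] unfolding V_def by blast
    then show False using that(3) by blast
  qed
  \<comment> \<open>Infinitely many maximal ideals that are cut out by a single \<open>F\<close> give the sequence at once.
    If there are only finitely many, some \<open>F0\<close> avoids all of them, and every \<open>B \<supseteq> F0\<close> can be
    split into two comaximal ones, repeatedly.\<close>
  define iso where "iso = {M. \<exists>F. ok F \<and> V F = {M}}"
  show ?thesis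
  proof (cases "finite iso")
    case False
    then obtain M :: "nat \<Rightarrow> 'a set" where M: "inj M" "range M \<subseteq> iso"
      using infinite_countable_subset by blast
    then have "\<forall>n. \<exists>F. ok F \<and> V F = {M n}" unfolding iso_def by blast
    then obtain F where F: "\<And>n. ok (F n)" "\<And>n. V (F n) = {M n}" by metis
    have "comaximal (?g (F m)) (?g (F n))" if "m \<noteq> n" for m n
      using sep[OF F(1) F(1), of m n] F(2) M(1) that by (auto dest: injD)
    then show ?thesis using that[of F] F(1) unfolding ok_def by blast
  next
    case True
    have "infinite ({M. maximal_ideal_of M R \<and> x \<in> M} - iso)" using inf True by simp
    then obtain M where M: "maximal_ideal_of M R" "x \<in> M" "M \<notin> iso"
      by (metis (no_types, lifting) Diff_iff finite.emptyI ex_in_conv mem_Collect_eq)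
    have "\<forall>N\<in>iso. \<exists>m. m \<in> M \<and> m \<notin> N"
    proof
      fix N assume N: "N \<in> iso"
      then have "maximal_ideal_of N R" unfolding iso_def V_def by blast
      then have "M \<subseteq> N \<longrightarrow> N = M" "N \<noteq> M"
        using M N max_ideal unfolding maximal_ideal_of_def by blast+
      then show "\<exists>m. m \<in> M \<and> m \<notin> N" by blast
    qed
    then obtain c where c: "\<And>N. N \<in> iso \<Longrightarrow> c N \<in> M \<and> c N \<notin> N" by metis
    \<comment> \<open>Each \<open>c N\<close> excludes \<open>N\<close> from \<open>V F0\<close>,
      while \<open>F0 \<subseteq> M\<close> keeps the generated ideal proper.\<close>
    define F0 where "F0 = insert x (c ` iso)"
    have F0_M: "F0 \<subseteq> M" using c M(2) unfolding F0_def by blast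
    have F0: "ok F0"
      using V_one[of M F0] F0_M M(1) True idealD(1)[OF max_ideal[OF M(1)]]
      unfolding ok_def V_def F0_def by blast
    \<comment> \<open>\<open>V B\<close> is nonempty and misses \<open>iso\<close>, so it has two
      distinct points \<open>N\<close> and \<open>N'\<close>. Writing \<open>1 = a + b\<close>
      across them, adjoin \<open>a\<close> to one copy of \<open>B\<close> and \<open>b\<close> to
      the other.\<close>
    have split: "\<exists>G H. ok G \<and> ok H \<and> B \<subseteq> G \<and> B \<subseteq> H \<and> comaximal (?g G) (?g H)"
      if B: "ok B" "F0 \<subseteq> B" for B
    proof -
      obtain N where N: "N \<in> V B" using V_ne[OF B(1)] by blast
      have "N \<notin> iso" using N c B(2) unfolding F0_def V_def by blast
      then have "V B \<noteq> {N}" using B(1) unfolding iso_def by blast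
      then obtain N' where N': "N' \<in> V B" "N' \<noteq> N" using N by blast
      have "\<not> N' \<subseteq> N"
        using N N' max_ideal unfolding V_def maximal_ideal_of_def by blast
      then obtain a b where ab: "a \<in> N" "b \<in> N'" "a + b = 1"
        using maximal_comaximal[OF R, of N N'] N N' max_ideal unfolding V_def comaximal_def by blast
      have GV: "N \<in> V (insert a B)" "N' \<in> V (insert b B)" using N N' ab unfolding V_def by auto
      have "a \<in> R" "b \<in> R" using ab N N' idealD(1)[OF max_ideal] unfolding V_def by blast+
      then have "ok (insert a B)" "ok (insert b B)"
        using B(1) V_one[OF GV(1)] V_one[OF GV(2)] unfolding ok_def by auto
      moreover have "comaximal (?g (insert a B)) (?g (insert b B))"
        using ab(3) subset_set_prod_sums[OF R] unfolding comaximal_def by blast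
      ultimately show ?thesis by blast
    qed
    \<comment> \<open>In each pair the first component becomes a term of the sequence and the second
      is split further. Every later term contains that second component, hence is comaximal to the
      first.\<close>
    have "\<exists>h. \<forall>n. (ok (fst (h n)) \<and> ok (snd (h n)) \<and> F0 \<subseteq> snd (h n)
          \<and> comaximal (?g (fst (h n))) (?g (snd (h n))))
        \<and> snd (h n) \<subseteq> fst (h (Suc n)) \<and> snd (h n) \<subseteq> snd (h (Suc n))"
    proof (rule dependent_nat_choice)
      show "\<exists>p. ok (fst p) \<and> ok (snd p) \<and> F0 \<subseteq> snd p \<and> comaximal (?g (fst p)) (?g (snd p))"
        using split[OF F0] by auto
    next
      fix p :: "'a set \<times> 'a set"
      assume "ok (fst p) \<and> ok (snd p) \<and> F0 \<subseteq> snd p \<and> comaximal (?g (fst p)) (?g (snd p))"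
      then obtain G H where "ok G" "ok H" "snd p \<subseteq> G" "snd p \<subseteq> H" "F0 \<subseteq> H"
        "comaximal (?g G) (?g H)"
        using split[of "snd p"] by blast
      then show "\<exists>q. (ok (fst q) \<and> ok (snd q) \<and> F0 \<subseteq> snd q \<and> comaximal (?g (fst q)) (?g (snd q)))
          \<and> snd p \<subseteq> fst q \<and> snd p \<subseteq> snd q"
        by (intro exI[of _ "(G, H)"]) simp
    qed
    then obtain h where h: "\<And>n. ok (fst (h n))" "\<And>n. comaximal (?g (fst (h n))) (?g (snd (h n)))"
      "\<And>n. snd (h n) \<subseteq> fst (h (Suc n))" "\<And>n. snd (h n) \<subseteq> snd (h (Suc n))"
      by blast
    have below: "snd (h m) \<subseteq> fst (h n)" if mn: "m < n" for m n
    proof -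
      obtain k where n: "n = Suc k" and k: "m \<le> k" using mn by (cases n) auto
      have "snd (h m) \<subseteq> snd (h k)" using lift_Suc_mono_le[of "\<lambda>n. snd (h n)"] h(4) k by blast
      then show ?thesis using h(3) n by blast
    qed
    have less: "comaximal (?g (fst (h m))) (?g (fst (h n)))" if "m < n" for m n
      using comaximal_mono[OF h(2) subset_refl set_prod_sums_mono[OF subset_refl below[OF that]]] .
    have "comaximal (?g (fst (h m))) (?g (fst (h n)))" if "m \<noteq> n" for m n
      using less comaximal_sym that by (metis linorder_neqE_nat)
    then show ?thesis using that[of "\<lambda>n. fst (h n)"] h(1) unfolding ok_def by blast
  qed
qed

section \<open>Finite character from finite stability\<close>

theorem theorem12:
  fixes R :: "'a::field set"
  assumes "quotient_field_of R"
    and "R \<noteq> UNIV"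
    and "finitely_stable R"
    and "LPI_domain R"
    and "\<forall>D. fractional_overring R D \<longrightarrow> LPI_domain D"
  shows "finite_character R"
  unfolding finite_character_def
proof (intro ballI impI, rule ccontr)
  fix x assume x: "x \<in> R" "x \<noteq> 0" and inf: "infinite {M. maximal_ideal_of M R \<and> x \<in> M}"
  have R: "subring R" using assms(1) by (simp add: quotient_field_of_def)
  obtain F :: "nat \<Rightarrow> 'a set"
    where F: "\<And>n. finite (F n)" "\<And>n. F n \<subseteq> R" "\<And>n. x \<in> F n"
      "\<And>n. 1 \<notin> set_prod_sums R (F n)"
      "\<And>m n. m \<noteq> n \<Longrightarrow> comaximal (set_prod_sums R (F m)) (set_prod_sums R (F n))"
    using comaximal_fg_sequence[OF R x(1) inf] by blast
  have I: "ideal_of (set_prod_sums R (F n)) R" for n by (rule ideal_generated[OF R F(2)])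
  have xI: "x \<in> set_prod_sums R (F n)" for n using F(3) subset_set_prod_sums[OF R] by blast
  have stable: "stable_ideal (set_prod_sums R (F n))" for n
  proof -
    have "finitely_generated_ideal (set_prod_sums R (F n)) R"
      unfolding finitely_generated_ideal_def
      by (intro exI[of _ "F n"] conjI F(1,2) refl)
    moreover have "set_prod_sums R (F n) \<noteq> {0}"
      using xI[of n] x(2) by (metis singletonD)
    ultimately show ?thesis
      using assms(3) I[of n] by (simp add: finitely_stable_def)
  qed
  show False
    by (rule no_comaximal_stable_sequence[OF R _ I F(4) stable F(5) x(2) xI]) (simp_all add: assms(5))
qed

end
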